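(* Let $\mathcal{X}$ be an open subset of $\mathbb{R}^d$ and $\Theta\subset\mathbb{R}$. Let $\mathcal{P}=(P_\theta)_{\theta\in\Theta}$ be a model on $\mathcal{X}$ with Lebesgue densities $p_\theta$, and assume it is DQM at an interior point $\theta_0$ of $\Theta$ with score function $s_{\theta_0}$ such that $\mathbb{E}_{\theta_0}[s_{\theta_0}(X)^2]<\infty$. For $\alpha>0$ let $\mathcal{J}^{\max,\alpha}_{\theta_0}:=\sup_{q\in\mathcal{Q}_\alpha}\mathcal{I}_{\theta_0}(q\circ\mathcal{P})$. Then for any $\alpha>0$, $$\frac{(e^\alpha-1)^2}{2e^\alpha(1+e^\alpha)}\left(\int_{\mathcal{X}}|s_{\theta_0}(x)|p_{\theta_0}(x)\,dx\right)^2\le\mathcal{J}^{\max,\alpha}_{\theta_0}\le\frac{(e^\alpha-1)^2}{4}\left(\int_{\mathcal{X}}|s_{\theta_0}(x)|p_{\theta_0}(x)\,dx\right)^2.$$ Consequently, $$\mathcal{J}^{\max,\alpha}_{\theta_0}\sim_{\alpha\to0}\frac{\alpha^2}{4}\left(\int_{\mathcal{X}}|s_{\theta_0}(x)|p_{\theta_0}(x)\,dx\right)^2.$$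
   Context: The notation $f(\alpha)\sim_{\alpha\to0}g(\alpha)$ means $f(\alpha)=g(\alpha)(1+o(1))$ as $\alpha\to0^+$. A model with densities $p_\theta$ with respect to Lebesgue measure on $\mathcal{X}$, $\Theta\subset\mathbb{R}$, is DQM (differentiable in quadratic mean) at an interior point $\theta_0$ with score function $s_{\theta_0}:\mathcal{X}\to\mathbb{R}$ (measurable) if $\int_{\mathcal{X}}\left(\sqrt{p_{\theta_0+h}}-\sqrt{p_{\theta_0}}-\tfrac12 h\,s_{\theta_0}\sqrt{p_{\theta_0}}\right)^2dx=o(h^2)$ as $h\to0$. $\mathcal{Q}_\alpha$ is the set of $\alpha$-LDP mechanisms from $\mathcal{X}$ to some finite or countable output space $\mathcal{Z}$, i.e. families $q_x(z)=P(Z=z\mid X=x)$, measurable in $x$, with $q_x$ a probability mass function on $\mathcal{Z}$, such that for all $z\in\mathcal{Z}$, $q_x(z)\le e^\alpha q_{x'}(z)$ for $dx\,dx'$-a.e. $(x,x')$. For $q\in\mathcal{Q}_\alpha$, $q\circ\mathcal{P}$ is the model on $\mathcal{Z}$ with mass functions $\widetilde p_\theta(z)=\int_{\mathcal{X}}q_x(z)p_\theta(x)\,dx$; it is DQM at $\theta_0$ with score $t_{\theta_0}(z)=\widetilde p_{\theta_0}(z)^{-1}\int_{\mathcal{X}}s_{\theta_0}(x)q_x(z)p_{\theta_0}(x)\,dx$ (when $\widetilde p_{\theta_0}(z)>0$), and its Fisher information is $\mathcal{I}_{\theta_0}(q\circ\mathcal{P})=\sum_{z:\,\widetilde p_{\theta_0}(z)>0}t_{\theta_0}(z)^2\,\widetilde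 p_{\theta_0}(z)$. *)

theory Defs
  imports "HOL-Probability.Probability" "HOL-Library.Landau_Symbols"
begin

abbreviation leb :: "'a::euclidean_space set \<Rightarrow> 'a measure" where
  "leb X \<equiv> restrict_space lborel X"

definition model_measure ::
    "'a::euclidean_space set \<Rightarrow> (real \<Rightarrow> 'a \<Rightarrow> real) \<Rightarrow> real \<Rightarrow> 'a measure" where
  "model_measure X p \<theta> = density (leb X) (\<lambda>x. ennreal (p \<theta> x))"

definition statistical_model ::
    "'a::euclidean_space set \<Rightarrow> real set \<Rightarrow> (real \<Rightarrow> 'a \<Rightarrow> real) \<Rightarrow> bool" where
  "statistical_model X \<Theta> p \<longleftrightarrow>
     (\<forall>\<theta>\<in>\<Theta>. p \<theta> \<in> borel_measurable (leb X) \<and> (\<forall>x\<in>X. 0 \<le> p \<theta> x)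
        \<and> prob_space (model_measure X p \<theta>))"

text \<open>Differentiability in quadratic mean at an interior point. The integral is a Bochner
  integral, which is 0 for non-integrable functions, so integrability for all small \<open>h\<close>
  is part of the definition.\<close>

definition DQM_remainder ::
    "(real \<Rightarrow> 'a \<Rightarrow> real) \<Rightarrow> ('a \<Rightarrow> real) \<Rightarrow> real \<Rightarrow> real \<Rightarrow> 'a \<Rightarrow> real" where
  "DQM_remainder p s \<theta>\<^sub>0 h x =
     sqrt (p (\<theta>\<^sub>0 + h) x) - sqrt (p \<theta>\<^sub>0 x) - 1 / 2 * h * s x * sqrt (p \<theta>\<^sub>0 x)"

definition DQM ::
    "'a::euclidean_space set \<Rightarrow> real set \<Rightarrow> (real \<Rightarrow> 'a \<Rightarrow> real) \<Rightarrow> real \<Rightarrow> ('a \<Rightarrow> real) \<Rightarrow> bool" where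
  "DQM X \<Theta> p \<theta>\<^sub>0 s \<longleftrightarrow>
     \<theta>\<^sub>0 \<in> interior \<Theta> \<and> s \<in> borel_measurable (leb X) \<and>
     (\<forall>\<^sub>F h in at 0. integrable (leb X) (\<lambda>x. (DQM_remainder p s \<theta>\<^sub>0 h x)\<^sup>2)) \<and>
     (\<lambda>h. LINT x|leb X. (DQM_remainder p s \<theta>\<^sub>0 h x)\<^sup>2) \<in> o[at 0](\<lambda>h. h\<^sup>2)"

definition ldp_mechanisms ::
    "'a::euclidean_space set \<Rightarrow> real \<Rightarrow> 'z set \<Rightarrow> ('a \<Rightarrow> 'z pmf) set" where
  "ldp_mechanisms X \<alpha> Z =
     {q. countable Z
       \<and> (\<forall>x\<in>X. set_pmf (q x) \<subseteq> Z)
       \<and> (\<forall>z\<in>Z. (\<lambda>x. pmf (q x) z) \<in> borel_measurable (leb X))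
       \<and> (\<forall>z\<in>Z. AE (x, x') in leb X \<Otimes>\<^sub>M leb X. pmf (q x) z \<le> exp \<alpha> * pmf (q x') z)}"

definition private_mass ::
    "'a::euclidean_space set \<Rightarrow> (real \<Rightarrow> 'a \<Rightarrow> real) \<Rightarrow> ('a \<Rightarrow> 'z pmf) \<Rightarrow> real \<Rightarrow> 'z \<Rightarrow> real" where
  "private_mass X p q \<theta> z = (LINT x|leb X. pmf (q x) z * p \<theta> x)"

definition private_score ::
    "'a::euclidean_space set \<Rightarrow> (real \<Rightarrow> 'a \<Rightarrow> real) \<Rightarrow> real \<Rightarrow> ('a \<Rightarrow> real) \<Rightarrow> ('a \<Rightarrow> 'z pmf) \<Rightarrow> 'z \<Rightarrow> real" where
  "private_score X p \<theta>\<^sub>0 s q z =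
     inverse (private_mass X p q \<theta>\<^sub>0 z) * (LINT x|leb X. s x * pmf (q x) z * p \<theta>\<^sub>0 x)"

text \<open>The information is a sum of nonnegative terms and is taken in \<open>[0, \<infinity>]\<close>, so that neither
  the sum nor the supremum below needs a side condition to be meaningful.\<close>

definition private_fisher_information ::
    "'a::euclidean_space set \<Rightarrow> (real \<Rightarrow> 'a \<Rightarrow> real) \<Rightarrow> real \<Rightarrow> ('a \<Rightarrow> real) \<Rightarrow> 'z set \<Rightarrow> ('a \<Rightarrow> 'z pmf) \<Rightarrow> ennreal" where
  "private_fisher_information X p \<theta>\<^sub>0 s Z q =
     (\<Sum>\<^sub>\<infinity>z\<in>{z\<in>Z. private_mass X p q \<theta>\<^sub>0 z > 0}.
        ennreal ((private_score X p \<theta>\<^sub>0 s q z)\<^sup>2 * private_mass X p q \<theta>\<^sub>0 z))"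

text \<open>The supremum ranges over all finite or countable output spaces. These are represented, up to
  relabelling, by the subsets of \<open>nat\<close>; the lemma after the definition confirms that
  mechanisms into countable subsets of any other type are covered.\<close>

definition max_private_information ::
    "'a::euclidean_space set \<Rightarrow> (real \<Rightarrow> 'a \<Rightarrow> real) \<Rightarrow> real \<Rightarrow> ('a \<Rightarrow> real) \<Rightarrow> real \<Rightarrow> ennreal" where
  "max_private_information X p \<theta>\<^sub>0 s \<alpha> =
     (SUP Z\<in>(UNIV :: nat set set). SUP q\<in>ldp_mechanisms X \<alpha> Z.
        private_fisher_information X p \<theta>\<^sub>0 s Z q)"

lemma private_fisher_information_le_max:
  fixes q :: "'a::euclidean_space \<Rightarrow> 'z pmf"
  assumes q: "q \<in> ldp_mechanisms X \<alpha> Z"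
  shows "private_fisher_information X p \<theta>\<^sub>0 s Z q \<le> max_private_information X p \<theta>\<^sub>0 s \<alpha>"
proof -
  define f where "f = to_nat_on Z"
  define r where "r x = map_pmf f (q x)" for x
  have cZ: "countable Z" and supp: "\<And>x. x \<in> X \<Longrightarrow> set_pmf (q x) \<subseteq> Z"
    using q by (auto simp: ldp_mechanisms_def)
  have inj: "inj_on f Z"
    unfolding f_def using cZ by (rule inj_on_to_nat_on)
  have r: "pmf (r x) (f z) = pmf (q x) z" if "x \<in> X" "z \<in> Z" for x z
  proof -
    have "pmf (r x) (f z) = measure (q x) (f -` {f z} \<inter> set_pmf (q x))"
      unfolding r_def pmf_map by (simp add: measure_Int_set_pmf)
    also have "f -` {f z} \<inter> set_pmf (q x) = {z} \<inter> set_pmf (q x)"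
      using inj supp[OF that(1)] that(2) by (auto dest: inj_onD)
    also have "measure (q x) \<dots> = pmf (q x) z"
      by (simp only: measure_Int_set_pmf measure_pmf_single)
    finally show ?thesis .
  qed
  have sp: "space (leb X) = X"
    by (simp add: space_restrict_space)
  have mass: "private_mass X p r \<theta>\<^sub>0 (f z) = private_mass X p q \<theta>\<^sub>0 z" if "z \<in> Z" for z
    unfolding private_mass_def using that by (intro Bochner_Integration.integral_cong) (auto simp: r sp)
  have score: "private_score X p \<theta>\<^sub>0 s r (f z) = private_score X p \<theta>\<^sub>0 s q z" if "z \<in> Z" for z
  proof -
    have "(LINT x|leb X. s x * pmf (r x) (f z) * p \<theta>\<^sub>0 x) = (LINT x|leb X. s x * pmf (q x) z * p \<theta>\<^sub>0 x)"
      using that by (intro Bochner_Integration.integral_cong) (auto simp: r sp)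
    then show ?thesis
      by (simp add: private_score_def mass that)
  qed
  have "r \<in> ldp_mechanisms X \<alpha> (f ` Z)"
  proof -
    have "(\<lambda>x. pmf (r x) (f z)) \<in> borel_measurable (leb X)" if "z \<in> Z" for z
    proof -
      have "(\<lambda>x. pmf (q x) z) \<in> borel_measurable (leb X)"
        using q that by (auto simp: ldp_mechanisms_def)
      then show ?thesis
        by (rule measurable_cong[THEN iffD1, rotated]) (simp add: r sp that)
    qed
    moreover have "AE (x, x') in leb X \<Otimes>\<^sub>M leb X. pmf (r x) (f z) \<le> exp \<alpha> * pmf (r x') (f z)"
      if "z \<in> Z" for z
    proof -
      have "AE (x, x') in leb X \<Otimes>\<^sub>M leb X. pmf (q x) z \<le> exp \<alpha> * pmf (q x') z"
        using q that by (auto simp: ldp_mechanisms_def)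
      then show ?thesis
        by (rule AE_mp) (rule AE_I2, auto simp: space_pair_measure sp r that)
    qed
    ultimately show ?thesis
      using supp cZ by (fastforce simp: ldp_mechanisms_def r_def)
  qed
  moreover have "private_fisher_information X p \<theta>\<^sub>0 s Z q = private_fisher_information X p \<theta>\<^sub>0 s (f ` Z) r"
  proof -
    let ?S = "{z\<in>Z. private_mass X p q \<theta>\<^sub>0 z > 0}"
    have *: "{y\<in>f ` Z. private_mass X p r \<theta>\<^sub>0 y > 0} = f ` ?S"
      by (auto simp: mass)
    have "inj_on f ?S"
      using inj by (rule inj_on_subset) auto
    then show ?thesis
      unfolding private_fisher_information_def *
      by (subst infsum_reindex) (auto intro!: infsum_cong simp: mass score)
  qed
  ultimately show ?thesis
    unfolding max_private_information_def by (auto intro!: SUP_upper2[of "f ` Z"] SUP_upper2[of r])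
qed

end

theory Submission imports Defs "HOL-Real_Asymp.Real_Asymp" begin

text \<open>
  Write \<open>A\<close> for the integral of \<open>\<bar>s\<bar> p\<close> at \<open>\<theta>\<^sub>0\<close>. All densities have integral one, so differentiability
  in quadratic mean forces the score to be centred (lemma \<open>DQM_score_centred\<close>). Hence, for an output \<open>z\<close>, the integral of \<open>s(x) q\<^sub>x(z) p(x)\<close> does not change when a
  constant is subtracted from \<open>q\<^sub>x(z)\<close>.

  Upper bound: by privacy, \<open>q\<^sub>x(z)\<close> lies almost everywhere in an interval \<open>[c, e\<^sup>\<alpha> c]\<close>, where \<open>c\<close> is
  essentially the infimum over \<open>x\<close> (lemma \<open>AE_bounded_ratio_imp_bounds\<close>). Subtracting the midpoint
  shows that the integral is at most \<open>c (e\<^sup>\<alpha> - 1) A / 2\<close> in absolute value, while the mass of \<open>z\<close> is at least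
  \<open>c\<close>. So \<open>z\<close> contributes at most \<open>(e\<^sup>\<alpha> - 1)\<^sup>2 A\<^sup>2 / 4\<close> times its mass, and the masses sum to at most one.

  Lower bound: randomized response on the sign of \<open>s\<close> has two outputs, with masses \<open>m\<close> and \<open>1 - m\<close>,
  whose score integrals are \<open>v\<close> and \<open>-v\<close> for \<open>v = (e\<^sup>\<alpha> - 1) A / (2 (e\<^sup>\<alpha> + 1))\<close>. Its information
  \<open>v\<^sup>2 / m + v\<^sup>2 / (1 - m)\<close> is at least \<open>4 v\<^sup>2\<close>, which is at least the claimed bound because
  \<open>e\<^sup>\<alpha> + 1 \<le> 2 e\<^sup>\<alpha>\<close>. Both bounds are equivalent to \<open>\<alpha>\<^sup>2 A\<^sup>2 / 4\<close> as \<open>\<alpha>\<close> tends to zero.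
\<close>

section \<open>The score is centred\<close>

lemma model_density_has_integral:
  assumes "statistical_model X \<Theta> p" "\<theta> \<in> \<Theta>"
  shows "has_bochner_integral (leb X) (p \<theta>) 1"
proof -
  have [measurable]: "p \<theta> \<in> borel_measurable (leb X)"
    and pos: "\<And>x. x \<in> X \<Longrightarrow> 0 \<le> p \<theta> x"
    and "prob_space (model_measure X p \<theta>)"
    using assms by (auto simp: statistical_model_def)
  then have "emeasure (model_measure X p \<theta>) (space (model_measure X p \<theta>)) = 1"
    by (simp add: prob_space.emeasure_space_1)
  then have "(\<integral>\<^sup>+x. ennreal (p \<theta> x) \<partial>leb X) = ennreal 1"
    by (simp add: model_measure_def emeasure_density cong: nn_integral_cong)
  then show ?thesis
    by (intro has_bochner_integral_nn_integral) (auto intro!: AE_I2 pos simp: space_restrict_space)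
qed

text \<open>With \<open>f = \<surd>p\<^sub>0\<close>, \<open>g = \<surd>p\<^sub>h\<close> and remainder \<open>r\<close>, this bounds \<open>p\<^sub>h - p\<^sub>0 - h s p\<^sub>0\<close> pointwise; the
  cross terms are split by the arithmetic-geometric mean inequality with a free weight \<open>w\<close>.\<close>

lemma square_expansion_bound:
  fixes f g h r s w :: real
  assumes r: "r = g - f - 1 / 2 * h * s * f" and w: "w > 0"
  shows "\<bar>g\<^sup>2 - f\<^sup>2 - h * s * f\<^sup>2\<bar> \<le> w * f\<^sup>2 + r\<^sup>2 / w + 5 / 4 * h\<^sup>2 * (s\<^sup>2 * f\<^sup>2) + 2 * r\<^sup>2"
proof -
  have g: "g = f + 1 / 2 * h * s * f + r"
    using r by simp
  define u where "u = h * s * f"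
  have eq: "g\<^sup>2 - f\<^sup>2 - h * s * f\<^sup>2 = u\<^sup>2 / 4 + r\<^sup>2 + 2 * f * r + u * r"
    unfolding g u_def by (simp add: power2_eq_square algebra_simps)
  have "0 \<le> (w * f - r)\<^sup>2 / w" "0 \<le> (w * f + r)\<^sup>2 / w"
    using w by auto
  then have 1: "\<bar>2 * f * r\<bar> \<le> w * f\<^sup>2 + r\<^sup>2 / w"
    using w by (auto simp: power2_eq_square field_simps abs_le_iff)
  have "0 \<le> (u - r)\<^sup>2" "0 \<le> (u + r)\<^sup>2" "0 \<le> u\<^sup>2" "0 \<le> r\<^sup>2"
    by auto
  then have 2: "\<bar>u * r\<bar> \<le> u\<^sup>2 + r\<^sup>2"
    unfolding power2_sum power2_diff abs_le_iff by linarith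
  have "\<bar>u\<^sup>2 / 4 + r\<^sup>2 + 2 * f * r + u * r\<bar> \<le> w * f\<^sup>2 + r\<^sup>2 / w + 5 / 4 * u\<^sup>2 + 2 * r\<^sup>2"
    using 1 2 \<open>0 \<le> u\<^sup>2\<close> \<open>0 \<le> r\<^sup>2\<close> by linarith
  then show ?thesis
    unfolding eq by (simp add: u_def power_mult_distrib mult.assoc)
qed

text \<open>Integrating that bound with weight \<open>w = \<eta> \<bar>h\<bar>\<close>, where the squared remainder has integral at most
  \<open>\<eta>\<^sup>2 h\<^sup>2\<close> for small \<open>h\<close>, and dividing by \<open>\<bar>h\<bar>\<close> bounds the mean of the score by \<open>2 \<eta>\<close> up to terms
  that vanish with \<open>h\<close>.\<close>

lemma DQM_score_centred:
  assumes model: "statistical_model X \<Theta> p" and DQM: "DQM X \<Theta> p \<theta>\<^sub>0 s"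
    and s1: "integrable (leb X) (\<lambda>x. s x * p \<theta>\<^sub>0 x)"
    and s2: "integrable (leb X) (\<lambda>x. (s x)\<^sup>2 * p \<theta>\<^sub>0 x)"
  shows "(LINT x|leb X. s x * p \<theta>\<^sub>0 x) = 0"
proof -
  define m where "m = (LINT x|leb X. s x * p \<theta>\<^sub>0 x)"
  define B where "B = (LINT x|leb X. (s x)\<^sup>2 * p \<theta>\<^sub>0 x)"
  define R where "R h = (LINT x|leb X. (DQM_remainder p s \<theta>\<^sub>0 h x)\<^sup>2)" for h
  have int: "\<theta>\<^sub>0 \<in> interior \<Theta>"
    and ev_int: "\<forall>\<^sub>F h in at 0. integrable (leb X) (\<lambda>x. (DQM_remainder p s \<theta>\<^sub>0 h x)\<^sup>2)"
    and R: "R \<in> o[at 0](\<lambda>h. h\<^sup>2)"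
    using DQM by (auto simp: DQM_def R_def[abs_def])
  have "\<bar>m\<bar> \<le> 2 * \<eta>" if "\<eta> > 0" for \<eta> :: real
  proof -
    have "((\<lambda>h. \<theta>\<^sub>0 + h) \<longlongrightarrow> \<theta>\<^sub>0 + 0) (at 0)"
      by (intro tendsto_intros)
    then have ev_in: "\<forall>\<^sub>F h in at 0. \<theta>\<^sub>0 + h \<in> interior \<Theta>"
      using int by (auto dest: topological_tendstoD)
    have ev_R: "\<forall>\<^sub>F h in at 0. norm (R h) \<le> \<eta>\<^sup>2 * norm (h\<^sup>2)"
      using landau_o.smallD[OF R, of "\<eta>\<^sup>2"] that by auto
    have ev_ne: "\<forall>\<^sub>F h in at 0. h \<noteq> (0::real)"
      by (simp add: eventually_at_filter)
    have "\<forall>\<^sub>F h in at 0. \<bar>m\<bar> \<le> 2 * \<eta> + 5 / 4 * \<bar>h\<bar> * B + 2 * \<eta>\<^sup>2 * \<bar>h\<bar>"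
      using ev_int ev_in ev_R ev_ne
    proof eventually_elim
      case (elim h)
      have h: "\<bar>h\<bar> > 0" and w: "\<eta> * \<bar>h\<bar> > 0"
        using elim that by auto
      have p0: "has_bochner_integral (leb X) (p \<theta>\<^sub>0) 1"
        and ph: "has_bochner_integral (leb X) (p (\<theta>\<^sub>0 + h)) 1"
        using model_density_has_integral[OF model] int elim(2) interior_subset by blast+
      note [simp] = p0[THEN has_bochner_integral_integral_eq] ph[THEN has_bochner_integral_integral_eq]
        p0[THEN integrable.intros] ph[THEN integrable.intros] s1 s2 elim(1)
      have pos: "0 \<le> p \<theta>\<^sub>0 x" "0 \<le> p (\<theta>\<^sub>0 + h) x" if "x \<in> X" for x
        using model int elim(2) interior_subset that by (auto simp: statistical_model_def)
      let ?d = "\<lambda>x. p (\<theta>\<^sub>0 + h) x - p \<theta>\<^sub>0 x - h * (s x * p \<theta>\<^sub>0 x)"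
      let ?b = "\<lambda>x. (\<eta> * \<bar>h\<bar>) * p \<theta>\<^sub>0 x + (DQM_remainder p s \<theta>\<^sub>0 h x)\<^sup>2 / (\<eta> * \<bar>h\<bar>)
        + 5 / 4 * h\<^sup>2 * ((s x)\<^sup>2 * p \<theta>\<^sub>0 x) + 2 * (DQM_remainder p s \<theta>\<^sub>0 h x)\<^sup>2"
      have "\<bar>h * m\<bar> = \<bar>LINT x|leb X. ?d x\<bar>"
        by (simp add: m_def)
      also have "\<dots> \<le> (LINT x|leb X. \<bar>?d x\<bar>)"
        by (rule integral_abs_bound)
      also have "\<dots> \<le> (LINT x|leb X. ?b x)"
      proof (rule integral_mono)
        fix x assume "x \<in> space (leb X)"
        then have "x \<in> X"
          by (simp add: space_restrict_space)
        then show "\<bar>?d x\<bar> \<le> ?b x"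
          using square_expansion_bound[OF DQM_remainder_def[of p s "\<theta>\<^sub>0" h x] w]
          by (simp add: pos mult.assoc)
      qed simp_all
      also have "\<dots> = \<eta> * \<bar>h\<bar> + R h / (\<eta> * \<bar>h\<bar>) + 5 / 4 * h\<^sup>2 * B + 2 * R h"
        by (simp add: R_def B_def)
      also have "\<dots> \<le> \<eta> * \<bar>h\<bar> + \<eta>\<^sup>2 * h\<^sup>2 / (\<eta> * \<bar>h\<bar>) + 5 / 4 * h\<^sup>2 * B + 2 * (\<eta>\<^sup>2 * h\<^sup>2)"
        using elim(3) w that by (intro add_mono divide_right_mono mult_left_mono) auto
      also have "\<dots> = \<bar>h\<bar> * (2 * \<eta> + 5 / 4 * \<bar>h\<bar> * B + 2 * \<eta>\<^sup>2 * \<bar>h\<bar>)"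
      proof -
        have "\<eta> * k + \<eta>\<^sup>2 * k\<^sup>2 / (\<eta> * k) + 5 / 4 * k\<^sup>2 * B + 2 * (\<eta>\<^sup>2 * k\<^sup>2)
            = k * (2 * \<eta> + 5 / 4 * k * B + 2 * \<eta>\<^sup>2 * k)" if "k > 0" for k
          using that \<open>\<eta> > 0\<close> by (simp add: field_simps power2_eq_square)
        from this[OF h] show ?thesis
          by simp
      qed
      finally show ?case
        using h by (simp add: abs_mult)
    qed
    moreover have "((\<lambda>h. 2 * \<eta> + 5 / 4 * \<bar>h\<bar> * B + 2 * \<eta>\<^sup>2 * \<bar>h\<bar>) \<longlongrightarrow>
        2 * \<eta> + 5 / 4 * \<bar>0\<bar> * B + 2 * \<eta>\<^sup>2 * \<bar>0\<bar>) (at 0)"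
      by (intro tendsto_intros)
    ultimately show ?thesis
      using tendsto_lowerbound[of _ "2 * \<eta>" "at (0::real)" "\<bar>m\<bar>"] by simp
  qed
  from this[of "\<bar>m\<bar> / 4"] show ?thesis
    unfolding m_def by (cases "m = 0") (auto simp: m_def)
qed

section \<open>The upper bound\<close>

text \<open>The constant \<open>c\<close> is the infimum of \<open>g\<close> over the points \<open>y\<close> for which \<open>g x \<le> K g y\<close> holds for almost
  all \<open>x\<close>; by Fubini these points form a set of full measure.\<close>

lemma AE_bounded_ratio_imp_bounds:
  fixes g :: "'a \<Rightarrow> real"
  assumes "sigma_finite_measure M" and [measurable]: "g \<in> borel_measurable M"
    and pos: "\<And>x. x \<in> space M \<Longrightarrow> 0 \<le> g x" and K: "K > 0"
    and ratio: "AE (x, y) in M \<Otimes>\<^sub>M M. g x \<le> K * g y"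
    and nontrivial: "\<not> (AE x in M. False)"
  obtains c where "0 \<le> c" "AE x in M. c \<le> g x \<and> g x \<le> K * c"
proof -
  interpret sigma_finite_measure M by fact
  interpret pair_sigma_finite M M ..
  define G where "G = {y \<in> space M. AE x in M. g x \<le> K * g y}"
  have "AE x in M. AE y in M. g x \<le> K * g y"
    using AE_pair[OF ratio] by simp
  then have "AE y in M. AE x in M. g x \<le> K * g y"
    by (subst AE_commute[symmetric]) auto
  then have AE_G: "AE y in M. y \<in> G"
    by (rule AE_mp) (auto simp: G_def)
  have ne: "G \<noteq> {}"
    using AE_G nontrivial by auto
  have bdd: "bdd_below (g ` G)"
    by (rule bdd_belowI2[of _ 0]) (auto simp: G_def pos)
  define c where "c = Inf (g ` G)"
  have "0 \<le> c"
    unfolding c_def using ne by (intro cINF_greatest) (auto simp: G_def pos)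
  moreover have "AE x in M. c \<le> g x"
    using AE_G by (rule AE_mp) (auto simp: c_def intro!: AE_I2 cINF_lower[OF bdd])
  moreover have "AE x in M. g x \<le> K * (c + 1 / real (Suc n))" for n
  proof -
    have "\<exists>y\<in>G. g y < c + 1 / real (Suc n)"
      using cINF_less_iff[OF ne bdd, of "c + 1 / real (Suc n)"] by (simp add: c_def)
    then obtain y where "y \<in> G" and y: "g y < c + 1 / real (Suc n)"
      by blast
    then have "AE x in M. g x \<le> K * g y"
      by (simp add: G_def)
    moreover have "K * g y \<le> K * (c + 1 / real (Suc n))"
      using y K by (intro mult_left_mono) auto
    ultimately show ?thesis
      by (elim AE_mp) (auto intro!: AE_I2)
  qed
  then have "AE x in M. \<forall>n. g x \<le> K * (c + 1 / real (Suc n))"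
    by (simp add: AE_all_countable)
  then have "AE x in M. g x \<le> K * c"
  proof (rule AE_mp, intro AE_I2 impI)
    fix x assume *: "\<forall>n. g x \<le> K * (c + 1 / real (Suc n))"
    have "(\<lambda>n. K * (c + 1 / real (Suc n))) \<longlonglongrightarrow> K * (c + 0)"
      by (intro tendsto_intros LIMSEQ_Suc[OF lim_1_over_n])
    then show "g x \<le> K * c"
      using * by (intro LIMSEQ_le_const[of _ "K * c"]) auto
  qed
  ultimately show ?thesis
    by (intro that[of c]) auto
qed

text \<open>The bound on the numerator of the private score at one output, with \<open>g\<close> the probability of that
  output and \<open>f\<close> the density; \<open>c\<close> also bounds the mass from below.\<close>

lemma centred_integral_bound:
  fixes f g s :: "'a \<Rightarrow> real"
  assumes f: "has_bochner_integral M f 1" and f_pos: "\<And>x. x \<in> space M \<Longrightarrow> 0 \<le> f x"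
    and sf: "has_bochner_integral M (\<lambda>x. s x * f x) 0"
    and [measurable]: "g \<in> borel_measurable M"
    and c: "0 \<le> c" and K: "1 \<le> K" and g: "AE x in M. c \<le> g x \<and> g x \<le> K * c"
  shows "\<bar>LINT x|M. s x * g x * f x\<bar> \<le> (K - 1) / 2 * (LINT x|M. \<bar>s x\<bar> * f x) * (LINT x|M. g x * f x)"
proof -
  let ?A = "LINT x|M. \<bar>s x\<bar> * f x"
  have If: "integrable M f" and Isf: "integrable M (\<lambda>x. s x * f x)"
    using f sf by (auto simp: has_bochner_integral_iff)
  have [measurable]: "f \<in> borel_measurable M"
    using If by (rule borel_measurable_integrable)
  have Iabs: "integrable M (\<lambda>x. \<bar>s x\<bar> * f x)"
    using integrable_abs[OF Isf]
    by (rule Bochner_Integration.integrable_cong[THEN iffD1, rotated 2]) (auto simp: abs_mult f_pos)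
  have A: "0 \<le> ?A"
    by (intro integral_nonneg_AE AE_I2) (simp add: f_pos)
  have bdd: "AE x in M. \<bar>g x\<bar> \<le> K * c"
    using g by (rule AE_mp) (use c in \<open>auto intro!: AE_I2\<close>)
  have Igf: "integrable M (\<lambda>x. g x * f x)"
  proof (rule Bochner_Integration.integrable_bound)
    show "AE x in M. norm (g x * f x) \<le> norm (K * c * f x)"
      using bdd
      by eventually_elim (use c K in \<open>simp add: abs_mult mult_right_mono\<close>)
  qed (use If in auto)
  have Isgf: "integrable M (\<lambda>x. g x * (s x * f x))"
  proof (rule Bochner_Integration.integrable_bound)
    show "AE x in M. norm (g x * (s x * f x)) \<le> norm (K * c * (s x * f x))"
      using bdd
      by eventually_elim (use c K in \<open>simp add: abs_mult mult_right_mono\<close>)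
    show "(\<lambda>x. g x * (s x * f x)) \<in> borel_measurable M"
      using borel_measurable_integrable[OF Isf] by measurable
  qed (use Isf in auto)
  have mass: "c \<le> (LINT x|M. g x * f x)"
  proof -
    have "c = (LINT x|M. c * f x)"
      using f by (simp add: has_bochner_integral_iff)
    also have "\<dots> \<le> (LINT x|M. g x * f x)"
    proof (rule integral_mono_AE)
      show "AE x in M. c * f x \<le> g x * f x"
        using g AE_space by eventually_elim (simp add: mult_right_mono f_pos)
    qed (use If Igf in auto)
    finally show ?thesis .
  qed
  \<comment> \<open>the midpoint of the interval containing the values of \<open>g\<close>\<close>
  let ?a = "c * (1 + K) / 2"
  have "(LINT x|M. s x * g x * f x) = (LINT x|M. g x * (s x * f x) - ?a * (s x * f x))"
  proof -
    have "(LINT x|M. g x * (s x * f x) - ?a * (s x * f x)) = (LINT x|M. g x * (s x * f x))"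
      using Isgf Isf sf by (simp add: has_bochner_integral_iff)
    then show ?thesis
      by (simp add: mult.assoc mult.left_commute)
  qed
  also have "\<bar>\<dots>\<bar> \<le> (LINT x|M. \<bar>g x * (s x * f x) - ?a * (s x * f x)\<bar>)"
    by (rule integral_abs_bound)
  also have "\<dots> \<le> (LINT x|M. c * (K - 1) / 2 * (\<bar>s x\<bar> * f x))"
  proof (rule integral_mono_AE)
    show "AE x in M. \<bar>g x * (s x * f x) - ?a * (s x * f x)\<bar> \<le> c * (K - 1) / 2 * (\<bar>s x\<bar> * f x)"
      using g
    proof (rule AE_mp, intro AE_I2 impI)
      fix x assume x: "x \<in> space M" and gx: "c \<le> g x \<and> g x \<le> K * c"
      have "g x * (s x * f x) - ?a * (s x * f x) = (g x - ?a) * (s x * f x)"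
        by (rule left_diff_distrib[symmetric])
      moreover have "\<bar>g x - ?a\<bar> \<le> c * (K - 1) / 2"
        using gx by (auto simp: abs_le_iff field_simps)
      ultimately show "\<bar>g x * (s x * f x) - ?a * (s x * f x)\<bar> \<le> c * (K - 1) / 2 * (\<bar>s x\<bar> * f x)"
        by (simp only: abs_mult abs_of_nonneg[OF f_pos[OF x]])
          (intro mult_right_mono, auto simp: f_pos x)
    qed
  qed (use Isgf Isf Iabs in auto)
  also have "\<dots> = c * ((K - 1) / 2 * ?A)"
    by simp
  also have "\<dots> \<le> (LINT x|M. g x * f x) * ((K - 1) / 2 * ?A)"
    using mass A K by (intro mult_right_mono) auto
  finally show ?thesis
    by (simp only: ac_simps)
qed

lemma private_mass_sum_le_1:
  assumes f: "has_bochner_integral (leb X) (p \<theta>) 1" and f_pos: "\<And>x. x \<in> X \<Longrightarrow> 0 \<le> p \<theta> x"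
    and meas: "\<And>z. z \<in> F \<Longrightarrow> (\<lambda>x. pmf (q x) z) \<in> borel_measurable (leb X)"
    and "finite F"
  shows "(\<Sum>z\<in>F. private_mass X p q \<theta> z) \<le> 1"
proof -
  have If: "integrable (leb X) (p \<theta>)"
    using f by (simp add: has_bochner_integral_iff)
  have I: "integrable (leb X) (\<lambda>x. pmf (q x) z * p \<theta> x)" if "z \<in> F" for z
    by (rule Bochner_Integration.integrable_bound[OF If])
      (use meas[OF that] borel_measurable_integrable[OF If] in
        \<open>auto intro!: AE_I2 mult_left_le_one_le simp: abs_mult pmf_le_1\<close>)
  have "(\<Sum>z\<in>F. private_mass X p q \<theta> z) = (LINT x|leb X. (\<Sum>z\<in>F. pmf (q x) z * p \<theta> x))"
    unfolding private_mass_def using I by (simp add: Bochner_Integration.integral_sum)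
  also have "\<dots> \<le> (LINT x|leb X. p \<theta> x)"
  proof (rule integral_mono)
    fix x assume "x \<in> space (leb X)"
    then have "x \<in> X"
      by (simp add: space_restrict_space)
    have "(\<Sum>z\<in>F. pmf (q x) z) = measure (q x) F"
      by (simp add: measure_measure_pmf_finite \<open>finite F\<close>)
    also have "\<dots> \<le> 1"
      by simp
    finally have "(\<Sum>z\<in>F. pmf (q x) z) * p \<theta> x \<le> 1 * p \<theta> x"
      using f_pos[OF \<open>x \<in> X\<close>] by (intro mult_right_mono)
    then show "(\<Sum>z\<in>F. pmf (q x) z * p \<theta> x) \<le> p \<theta> x"
      by (simp add: sum_distrib_right)
  qed (use I If in auto)
  also have "\<dots> = 1"
    using f by (simp add: has_bochner_integral_iff)
  finally show ?thesis .
qed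

lemma private_fisher_information_upper_bound:
  fixes X :: "'a::euclidean_space set"
  assumes f: "has_bochner_integral (leb X) (p \<theta>\<^sub>0) 1" and f_pos: "\<And>x. x \<in> X \<Longrightarrow> 0 \<le> p \<theta>\<^sub>0 x"
    and sf: "has_bochner_integral (leb X) (\<lambda>x. s x * p \<theta>\<^sub>0 x) 0"
    and X: "X \<in> sets lborel"
    and \<alpha>: "\<alpha> \<ge> 0" and q: "q \<in> ldp_mechanisms X \<alpha> Z"
  shows "private_fisher_information X p \<theta>\<^sub>0 s Z q
    \<le> ennreal ((exp \<alpha> - 1)\<^sup>2 / 4 * (LINT x|leb X. \<bar>s x\<bar> * p \<theta>\<^sub>0 x)\<^sup>2)"
proof -
  let ?A = "LINT x|leb X. \<bar>s x\<bar> * p \<theta>\<^sub>0 x"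
  let ?C = "(exp \<alpha> - 1)\<^sup>2 / 4 * ?A\<^sup>2"
  have sp: "space (leb X) = X"
    by (simp add: space_restrict_space)
  have meas: "(\<lambda>x. pmf (q x) z) \<in> borel_measurable (leb X)"
    and ldp: "AE (x, x') in leb X \<Otimes>\<^sub>M leb X. pmf (q x) z \<le> exp \<alpha> * pmf (q x') z" if "z \<in> Z" for z
    using q that by (auto simp: ldp_mechanisms_def)
  have nontrivial: "\<not> (AE x in leb X. False)"
  proof
    assume "AE x in leb X. False"
    then have "(LINT x|leb X. p \<theta>\<^sub>0 x) = 0"
      by (intro integral_eq_zero_AE) auto
    then show False
      using f by (simp add: has_bochner_integral_iff)
  qed
  have sigma: "sigma_finite_measure (leb X)"
    using X by (intro sigma_finite_measure_restrict_space sigma_finite_lborel)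
  have term_le: "(private_score X p \<theta>\<^sub>0 s q z)\<^sup>2 * private_mass X p q \<theta>\<^sub>0 z
      \<le> ?C * private_mass X p q \<theta>\<^sub>0 z"
    if z: "z \<in> Z" and m: "private_mass X p q \<theta>\<^sub>0 z > 0" for z
  proof -
    let ?m = "private_mass X p q \<theta>\<^sub>0 z"
    let ?v = "LINT x|leb X. s x * pmf (q x) z * p \<theta>\<^sub>0 x"
    obtain c where c: "0 \<le> c" "AE x in leb X. c \<le> pmf (q x) z \<and> pmf (q x) z \<le> exp \<alpha> * c"
      by (rule AE_bounded_ratio_imp_bounds[OF sigma meas[OF z] _ _ ldp[OF z] nontrivial]) auto
    have "\<bar>?v\<bar> \<le> (exp \<alpha> - 1) / 2 * ?A * ?m"
      unfolding private_mass_def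
      by (rule centred_integral_bound[OF f _ sf meas[OF z] c(1) _ c(2)]) (use \<alpha> f_pos sp in auto)
    then have "\<bar>?v\<bar> / ?m \<le> (exp \<alpha> - 1) / 2 * ?A"
      using m by (simp add: pos_divide_le_eq)
    then have "(\<bar>?v\<bar> / ?m)\<^sup>2 \<le> ((exp \<alpha> - 1) / 2 * ?A)\<^sup>2"
      using m by (intro power_mono) auto
    moreover have "private_score X p \<theta>\<^sub>0 s q z = ?v / ?m"
      by (simp only: private_score_def divide_inverse mult.commute)
    ultimately have "(private_score X p \<theta>\<^sub>0 s q z)\<^sup>2 \<le> ?C"
      by (simp add: power_mult_distrib power_divide)
    then show ?thesis
      using m by (intro mult_right_mono) auto
  qed
  show ?thesis
    unfolding private_fisher_information_def
  proof (rule infsum_le_finite_sums)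
    fix F assume "finite F" and F: "F \<subseteq> {z \<in> Z. 0 < private_mass X p q \<theta>\<^sub>0 z}"
    have "(\<Sum>z\<in>F. ennreal ((private_score X p \<theta>\<^sub>0 s q z)\<^sup>2 * private_mass X p q \<theta>\<^sub>0 z))
        = ennreal (\<Sum>z\<in>F. (private_score X p \<theta>\<^sub>0 s q z)\<^sup>2 * private_mass X p q \<theta>\<^sub>0 z)"
      using F by (intro sum_ennreal) (auto simp: less_imp_le)
    also have "\<dots> \<le> ennreal (\<Sum>z\<in>F. ?C * private_mass X p q \<theta>\<^sub>0 z)"
      using F by (intro ennreal_leI sum_mono term_le) auto
    also have "\<dots> \<le> ennreal ?C"
    proof (rule ennreal_leI)
      have "(\<Sum>z\<in>F. private_mass X p q \<theta>\<^sub>0 z) \<le> 1"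
        by (rule private_mass_sum_le_1[where X = X and q = q and p = p and \<theta> = "\<theta>\<^sub>0", OF f f_pos meas \<open>finite F\<close>]) (use F in auto)
      then have "?C * (\<Sum>z\<in>F. private_mass X p q \<theta>\<^sub>0 z) \<le> ?C * 1"
        by (intro mult_left_mono) auto
      then show "(\<Sum>z\<in>F. ?C * private_mass X p q \<theta>\<^sub>0 z) \<le> ?C"
        by (simp add: sum_distrib_left)
    qed
    finally show "(\<Sum>z\<in>F. ennreal ((private_score X p \<theta>\<^sub>0 s q z)\<^sup>2 * private_mass X p q \<theta>\<^sub>0 z)) \<le> ennreal ?C" .
  qed (rule nonneg_summable_on_complete, simp)
qed

section \<open>Randomized response on the sign of the score\<close>

text \<open>The probability with which randomized response reports a nonnegative score at \<open>x\<close>; a score equal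
  to zero counts as nonnegative.\<close>

definition sign_response_prob :: "real \<Rightarrow> ('a \<Rightarrow> real) \<Rightarrow> 'a \<Rightarrow> real" where
  "sign_response_prob \<alpha> s x = (if 0 \<le> s x then exp \<alpha> else 1) / (1 + exp \<alpha>)"

text \<open>The mechanism with outputs \<open>{0, 1}\<close> that reports whether the score is nonnegative, truthfully
  with probability \<open>e\<^sup>\<alpha> / (1 + e\<^sup>\<alpha>)\<close>; output \<open>1\<close> has probability \<open>sign_response_prob\<close>.\<close>

definition sign_response :: "real \<Rightarrow> ('a \<Rightarrow> real) \<Rightarrow> 'a \<Rightarrow> nat pmf" where
  "sign_response \<alpha> s x = map_pmf of_bool (bernoulli_pmf (sign_response_prob \<alpha> s x))"

lemma sign_response_prob_bounds: "0 \<le> sign_response_prob \<alpha> s x" "sign_response_prob \<alpha> s x \<le> 1"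
  by (auto simp: sign_response_prob_def field_simps add_pos_pos)

lemma pmf_sign_response:
  "pmf (sign_response \<alpha> s x) (Suc 0) = sign_response_prob \<alpha> s x"
  "pmf (sign_response \<alpha> s x) 0 = 1 - sign_response_prob \<alpha> s x"
proof -
  have inj: "inj (of_bool :: bool \<Rightarrow> nat)"
    by (auto simp: inj_def)
  show "pmf (sign_response \<alpha> s x) (Suc 0) = sign_response_prob \<alpha> s x"
    "pmf (sign_response \<alpha> s x) 0 = 1 - sign_response_prob \<alpha> s x"
    using pmf_map_inj'[OF inj, of "bernoulli_pmf (sign_response_prob \<alpha> s x)" True]
      pmf_map_inj'[OF inj, of "bernoulli_pmf (sign_response_prob \<alpha> s x)" False]
    by (auto simp: sign_response_def sign_response_prob_bounds)
qed

lemma sign_response_private: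
  assumes [measurable]: "s \<in> borel_measurable (leb X)" and \<alpha>: "\<alpha> \<ge> 0"
  shows "sign_response \<alpha> s \<in> ldp_mechanisms X \<alpha> {0, 1}"
proof -
  have e: "1 \<le> exp \<alpha>" "0 < 1 + exp \<alpha>"
    using \<alpha> by (auto simp: add_pos_pos)
  have e2: "1 \<le> exp \<alpha> * exp \<alpha>"
    using mult_mono[OF e(1) e(1)] by simp
  have [measurable]: "sign_response_prob \<alpha> s \<in> borel_measurable (leb X)"
    unfolding sign_response_prob_def[abs_def] by measurable
  have 1: "1 - sign_response_prob \<alpha> s x = (if 0 \<le> s x then 1 else exp \<alpha>) / (1 + exp \<alpha>)" for x
    using e by (simp add: sign_response_prob_def field_simps)
  have "sign_response_prob \<alpha> s x \<le> exp \<alpha> * sign_response_prob \<alpha> s y" for x y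
    using e e2 by (simp add: sign_response_prob_def divide_right_mono)
  moreover have "1 - sign_response_prob \<alpha> s x \<le> exp \<alpha> * (1 - sign_response_prob \<alpha> s y)" for x y
    unfolding 1 using e e2 by (simp add: divide_right_mono)
  moreover have "set_pmf (sign_response \<alpha> s x) \<subseteq> {0, 1}" for x
    by (auto simp: sign_response_def)
  ultimately show ?thesis
    by (auto simp: ldp_mechanisms_def pmf_sign_response)
qed

lemma sign_response_information:
  fixes X :: "'a::euclidean_space set"
  assumes f: "has_bochner_integral (leb X) (p \<theta>\<^sub>0) 1" and f_pos: "\<And>x. x \<in> X \<Longrightarrow> 0 \<le> p \<theta>\<^sub>0 x"
    and sf: "has_bochner_integral (leb X) (\<lambda>x. s x * p \<theta>\<^sub>0 x) 0"
    and [measurable]: "s \<in> borel_measurable (leb X)" and \<alpha>: "\<alpha> \<ge> 0"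
  shows "ennreal (((exp \<alpha> - 1) / (exp \<alpha> + 1) * (LINT x|leb X. \<bar>s x\<bar> * p \<theta>\<^sub>0 x))\<^sup>2)
    \<le> private_fisher_information X p \<theta>\<^sub>0 s {0, 1} (sign_response \<alpha> s)"
proof -
  let ?q = "sign_response \<alpha> s" and ?g = "sign_response_prob \<alpha> s" and ?f = "p \<theta>\<^sub>0"
  define A where "A = (LINT x|leb X. \<bar>s x\<bar> * ?f x)"
  \<comment> \<open>the smaller response probability, which keeps both output masses positive\<close>
  define \<kappa> where "\<kappa> = 1 / (1 + exp \<alpha>)"
  define v where "v = (exp \<alpha> - 1) / (exp \<alpha> + 1) * A / 2"
  define m where "m = private_mass X p ?q \<theta>\<^sub>0 1"
  have e: "1 \<le> exp \<alpha>" "0 < 1 + exp \<alpha>"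
    using \<alpha> by (auto simp: add_pos_pos)
  have sp: "space (leb X) = X"
    by (simp add: space_restrict_space)
  have [measurable]: "?g \<in> borel_measurable (leb X)"
    unfolding sign_response_prob_def[abs_def] by measurable
  have If: "integrable (leb X) ?f" and Isf: "integrable (leb X) (\<lambda>x. s x * ?f x)"
    and f1: "(LINT x|leb X. ?f x) = 1" and sf0: "(LINT x|leb X. s x * ?f x) = 0"
    using f sf by (auto simp: has_bochner_integral_iff)
  have [measurable]: "?f \<in> borel_measurable (leb X)"
    using If by (rule borel_measurable_integrable)
  have Iabs: "integrable (leb X) (\<lambda>x. \<bar>s x\<bar> * ?f x)"
    using integrable_abs[OF Isf]
    by (rule Bochner_Integration.integrable_cong[THEN iffD1, rotated 2]) (auto simp: abs_mult f_pos sp)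
  have Igf: "integrable (leb X) (\<lambda>x. ?g x * ?f x)"
    by (rule Bochner_Integration.integrable_bound[OF If])
      (auto intro!: AE_I2 mult_left_le_one_le simp: abs_mult sign_response_prob_bounds)
  \<comment> \<open>the response probability is \<open>1/2\<close> plus \<open>(e\<^sup>\<alpha> - 1) / (2 (e\<^sup>\<alpha> + 1))\<close> times the sign of the score\<close>
  have sg: "s x * ?g x * ?f x = s x * ?f x / 2 + (exp \<alpha> - 1) / (exp \<alpha> + 1) / 2 * (\<bar>s x\<bar> * ?f x)" for x
  proof -
    have "?g x = 1 / 2 + (exp \<alpha> - 1) / (exp \<alpha> + 1) / 2 * (if 0 \<le> s x then 1 else -1)"
      using e by (auto simp: sign_response_prob_def divide_simps)
    moreover have "s x * (if 0 \<le> s x then 1 else -1) = \<bar>s x\<bar>"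
      by simp
    ultimately show ?thesis
      by (auto simp: algebra_simps)
  qed
  have v1: "(LINT x|leb X. s x * pmf (?q x) 1 * ?f x) = v"
    using Isf Iabs sf0 by (simp add: pmf_sign_response sg v_def A_def)
  have Isg: "integrable (leb X) (\<lambda>x. s x * ?g x * ?f x)"
    unfolding sg using Isf Iabs by simp
  have v0: "(LINT x|leb X. s x * pmf (?q x) 0 * ?f x) = - v"
  proof -
    have "(LINT x|leb X. s x * pmf (?q x) 0 * ?f x) = (LINT x|leb X. s x * ?f x - s x * ?g x * ?f x)"
      by (simp add: pmf_sign_response algebra_simps)
    also have "\<dots> = - v"
      using Isf Isg sf0 v1 by (simp add: pmf_sign_response)
    finally show ?thesis .
  qed
  have m0: "private_mass X p ?q \<theta>\<^sub>0 0 = 1 - m"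
  proof -
    have "private_mass X p ?q \<theta>\<^sub>0 0 = (LINT x|leb X. ?f x - ?g x * ?f x)"
      by (simp add: private_mass_def pmf_sign_response algebra_simps)
    also have "\<dots> = 1 - m"
      using If Igf f1 by (simp add: m_def private_mass_def pmf_sign_response)
    finally show ?thesis .
  qed
  have \<kappa>: "0 < \<kappa>" "\<kappa> \<le> ?g x" "\<kappa> \<le> 1 - ?g x" for x
    using e by (auto simp: \<kappa>_def sign_response_prob_def field_simps)
  have m_pos: "0 < m"
  proof -
    have "\<kappa> = (LINT x|leb X. \<kappa> * ?f x)"
      using f1 by simp
    also have "\<dots> \<le> (LINT x|leb X. ?g x * ?f x)"
      using If Igf by (intro integral_mono mult_right_mono \<kappa>) (auto simp: sp f_pos)
    finally show ?thesis
      using \<kappa>(1) by (simp add: m_def private_mass_def pmf_sign_response)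
  qed
  have m_less: "m < 1"
  proof -
    have "m = (LINT x|leb X. ?g x * ?f x)"
      by (simp add: m_def private_mass_def pmf_sign_response)
    also have "\<dots> \<le> (LINT x|leb X. (1 - \<kappa>) * ?f x)"
      using If Igf \<kappa>(3) by (intro integral_mono mult_right_mono) (auto simp: sp f_pos le_diff_eq add.commute)
    also have "\<dots> = 1 - \<kappa>"
      using f1 by simp
    finally show ?thesis
      using \<kappa>(1) by simp
  qed
  have "((exp \<alpha> - 1) / (exp \<alpha> + 1) * A)\<^sup>2 = 4 * v\<^sup>2"
  proof -
    have "2 * v = (exp \<alpha> - 1) / (exp \<alpha> + 1) * A"
      unfolding v_def by (simp only: times_divide_eq_right nonzero_mult_div_cancel_left zero_neq_numeral not_False_eq_True)
    then show ?thesis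
      using power_mult_distrib[of 2 v 2] by simp
  qed
  also have "\<dots> \<le> v\<^sup>2 / m + v\<^sup>2 / (1 - m)"
  proof -
    have "4 * (m * (1 - m)) \<le> 1"
      using zero_le_power2[of "2 * m - 1"] by (simp add: power2_eq_square algebra_simps)
    moreover have "0 < m * (1 - m)"
      using m_pos m_less by simp
    ultimately have "4 \<le> 1 / (m * (1 - m))"
      by (simp add: le_divide_eq)
    then have "v\<^sup>2 * 4 \<le> v\<^sup>2 * (1 / (m * (1 - m)))"
      by (intro mult_left_mono) auto
    also have "\<dots> = v\<^sup>2 / m + v\<^sup>2 / (1 - m)"
      using m_pos m_less by (simp add: divide_simps) (simp add: algebra_simps)
    finally show ?thesis
      by simp
  qed
  finally have "ennreal (((exp \<alpha> - 1) / (exp \<alpha> + 1) * A)\<^sup>2) \<le> ennreal (v\<^sup>2 / m + v\<^sup>2 / (1 - m))"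
    by (rule ennreal_leI)
  also have "\<dots> = private_fisher_information X p \<theta>\<^sub>0 s {0, 1} ?q"
  proof -
    have "{z \<in> {0, 1}. private_mass X p ?q \<theta>\<^sub>0 z > 0} = {0, 1}"
      using m_pos m_less m0 by (auto simp: m_def)
    moreover have "(private_score X p \<theta>\<^sub>0 s ?q 1)\<^sup>2 * private_mass X p ?q \<theta>\<^sub>0 1 = v\<^sup>2 / m"
      unfolding private_score_def v1 m_def[symmetric] using m_pos
      by (simp add: power2_eq_square field_simps)
    moreover have "(private_score X p \<theta>\<^sub>0 s ?q 0)\<^sup>2 * private_mass X p ?q \<theta>\<^sub>0 0 = v\<^sup>2 / (1 - m)"
      unfolding private_score_def v0 m0 using m_less
      by (simp add: power2_eq_square divide_simps)
    ultimately show ?thesis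
      using m_pos m_less unfolding private_fisher_information_def
      by (simp add: ennreal_plus[symmetric] add.commute del: ennreal_plus)
  qed
  finally show ?thesis
    by (simp add: A_def)
qed

section \<open>Bounds and small-privacy asymptotics\<close>

theorem theorem2:
  fixes X :: "'a::euclidean_space set" and \<Theta> :: "real set"
    and p :: "real \<Rightarrow> 'a \<Rightarrow> real" and s :: "'a \<Rightarrow> real" and \<theta>\<^sub>0 :: real
  assumes "open X"
    and "statistical_model X \<Theta> p"
    and "DQM X \<Theta> p \<theta>\<^sub>0 s"
    and "integrable (model_measure X p \<theta>\<^sub>0) (\<lambda>x. (s x)\<^sup>2)"
  shows "(\<forall>\<alpha>>0.
      ennreal ((exp \<alpha> - 1)\<^sup>2 / (2 * exp \<alpha> * (1 + exp \<alpha>)) * (LINT x|leb X. \<bar>s x\<bar> * p \<theta>\<^sub>0 x)\<^sup>2)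
        \<le> max_private_information X p \<theta>\<^sub>0 s \<alpha>
    \<and> max_private_information X p \<theta>\<^sub>0 s \<alpha>
        \<le> ennreal ((exp \<alpha> - 1)\<^sup>2 / 4 * (LINT x|leb X. \<bar>s x\<bar> * p \<theta>\<^sub>0 x)\<^sup>2))
    \<and> (\<lambda>\<alpha>. enn2real (max_private_information X p \<theta>\<^sub>0 s \<alpha>))
        \<sim>[at_right 0] (\<lambda>\<alpha>. \<alpha>\<^sup>2 / 4 * (LINT x|leb X. \<bar>s x\<bar> * p \<theta>\<^sub>0 x)\<^sup>2)"
proof -
  define A where "A = (LINT x|leb X. \<bar>s x\<bar> * p \<theta>\<^sub>0 x)"
  let ?J = "max_private_information X p \<theta>\<^sub>0 s"
  let ?lo = "\<lambda>\<alpha>. (exp \<alpha> - 1)\<^sup>2 / (2 * exp \<alpha> * (1 + exp \<alpha>)) * A\<^sup>2"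
  let ?up = "\<lambda>\<alpha>. (exp \<alpha> - 1)\<^sup>2 / 4 * A\<^sup>2"
  have X: "X \<in> sets lborel"
    using \<open>open X\<close> by simp
  have sp: "space (leb X) = X"
    by (simp add: space_restrict_space)
  have \<theta>\<^sub>0: "\<theta>\<^sub>0 \<in> \<Theta>" and s_meas [measurable]: "s \<in> borel_measurable (leb X)"
    using assms(3) interior_subset by (auto simp: DQM_def)
  have f: "has_bochner_integral (leb X) (p \<theta>\<^sub>0) 1"
    by (rule model_density_has_integral[OF assms(2) \<theta>\<^sub>0])
  have f_pos: "\<And>x. x \<in> X \<Longrightarrow> 0 \<le> p \<theta>\<^sub>0 x" and [measurable]: "p \<theta>\<^sub>0 \<in> borel_measurable (leb X)"
    using assms(2) \<theta>\<^sub>0 by (auto simp: statistical_model_def)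
  have AE_pos: "AE x in leb X. 0 \<le> p \<theta>\<^sub>0 x"
    by (auto intro!: AE_I2 simp: sp f_pos)
  have s2: "integrable (leb X) (\<lambda>x. (s x)\<^sup>2 * p \<theta>\<^sub>0 x)"
    using assms(4) AE_pos by (simp add: model_measure_def integrable_density mult.commute)
  have s1: "integrable (leb X) (\<lambda>x. s x * p \<theta>\<^sub>0 x)"
  proof (rule Bochner_Integration.integrable_bound)
    show "integrable (leb X) (\<lambda>x. p \<theta>\<^sub>0 x + (s x)\<^sup>2 * p \<theta>\<^sub>0 x)"
      using f s2 by (auto simp: has_bochner_integral_iff)
    have le: "\<bar>y\<bar> \<le> 1 + y\<^sup>2" for y :: real
      using zero_le_power2[of "\<bar>y\<bar> - 1"] zero_le_power2[of y]
      by (simp add: power2_diff)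
    show "AE x in leb X. norm (s x * p \<theta>\<^sub>0 x) \<le> norm (p \<theta>\<^sub>0 x + (s x)\<^sup>2 * p \<theta>\<^sub>0 x)"
      using AE_pos
    proof eventually_elim
      case (elim x)
      then show ?case
        using mult_right_mono[OF le[of "s x"] elim] by (simp add: abs_mult distrib_right)
    qed
  qed simp
  have sf: "has_bochner_integral (leb X) (\<lambda>x. s x * p \<theta>\<^sub>0 x) 0"
    using s1 DQM_score_centred[OF assms(2,3) s1 s2] by (simp add: has_bochner_integral_iff)
  have lower: "ennreal (?lo \<alpha>) \<le> ?J \<alpha>" if \<alpha>: "\<alpha> > 0" for \<alpha>
  proof -
    let ?e = "exp \<alpha>"
    have e: "1 \<le> ?e" "0 < ?e + 1"
      using \<alpha> by (auto simp: add_pos_pos)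
    have "?lo \<alpha> \<le> (?e - 1)\<^sup>2 / (?e + 1)\<^sup>2 * A\<^sup>2"
    proof (intro mult_right_mono divide_left_mono)
      have "(?e + 1) * (?e + 1) \<le> (2 * ?e) * (?e + 1)"
        using e by (intro mult_right_mono) auto
      then show "(?e + 1)\<^sup>2 \<le> 2 * ?e * (1 + ?e)"
        by (simp add: power2_eq_square add.commute)
    qed (use e in \<open>auto intro!: mult_pos_pos zero_less_power\<close>)
    then have "?lo \<alpha> \<le> ((?e - 1) / (?e + 1) * A)\<^sup>2"
      by (simp add: power_mult_distrib power_divide)
    then have "ennreal (?lo \<alpha>) \<le> ennreal (((?e - 1) / (?e + 1) * A)\<^sup>2)"
      by (rule ennreal_leI)
    also have "\<dots> \<le> private_fisher_information X p \<theta>\<^sub>0 s {0, 1} (sign_response \<alpha> s)"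
      unfolding A_def using sign_response_information[where p = p and \<theta>\<^sub>0 = "\<theta>\<^sub>0", OF f f_pos sf s_meas] \<alpha> by simp
    also have "\<dots> \<le> ?J \<alpha>"
      using \<alpha> by (intro private_fisher_information_le_max sign_response_private s_meas) simp
    finally show ?thesis .
  qed
  have upper: "?J \<alpha> \<le> ennreal (?up \<alpha>)" if "\<alpha> > 0" for \<alpha>
    unfolding max_private_information_def A_def
    using that by (intro SUP_least private_fisher_information_upper_bound[where p = p and \<theta>\<^sub>0 = "\<theta>\<^sub>0", OF f f_pos sf X]) auto
  have "(\<lambda>\<alpha>. enn2real (?J \<alpha>)) \<sim>[at_right 0] (\<lambda>\<alpha>. \<alpha>\<^sup>2 / 4 * A\<^sup>2)"
  proof (rule asymp_equiv_sandwich_real)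
    have "(\<lambda>\<alpha>::real. (exp \<alpha> - 1)\<^sup>2 / (2 * exp \<alpha> * (1 + exp \<alpha>))) \<sim>[at_right 0] (\<lambda>\<alpha>. \<alpha>\<^sup>2 / 4)"
      by real_asymp
    then show "?lo \<sim>[at_right 0] (\<lambda>\<alpha>. \<alpha>\<^sup>2 / 4 * A\<^sup>2)"
      by (rule asymp_equiv_mult) (rule asymp_equiv_refl)
    have "(\<lambda>\<alpha>::real. (exp \<alpha> - 1)\<^sup>2 / 4) \<sim>[at_right 0] (\<lambda>\<alpha>. \<alpha>\<^sup>2 / 4)"
      by real_asymp
    then show "?up \<sim>[at_right 0] (\<lambda>\<alpha>. \<alpha>\<^sup>2 / 4 * A\<^sup>2)"
      by (rule asymp_equiv_mult) (rule asymp_equiv_refl)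
    have "\<forall>\<^sub>F \<alpha> in at_right 0. \<alpha> > (0::real)"
      by (rule eventually_at_right_less)
    then show "\<forall>\<^sub>F \<alpha> in at_right 0. enn2real (?J \<alpha>) \<in> {?lo \<alpha>..?up \<alpha>}"
    proof eventually_elim
      case (elim \<alpha>)
      have fin: "?J \<alpha> < \<top>"
        using upper[OF elim] by (rule le_less_trans) simp
      have "?lo \<alpha> \<le> enn2real (?J \<alpha>)"
        using enn2real_mono[OF lower[OF elim] fin] elim by (simp add: add_nonneg_nonneg)
      moreover have "enn2real (?J \<alpha>) \<le> ?up \<alpha>"
        using upper[OF elim] by (intro enn2real_leI) auto
      ultimately show ?case
        by simp
    qed
  qed
  then show ?thesis
    using lower upper unfolding A_def by blast
qed

end
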